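(* Let $p>0$ be an integer. Then for every $x$ with $|x|<1$, $$\sum_{n=1}^{\infty}\left(1^p+2^p+\dots+n^p\right)x^n = \frac{1}{(1-x)^2}\,\omega_p\!\left(\frac{x}{1-x}\right).$$
   Context: $S(p,k)$ denotes the Stirling numbers of the second kind. The geometric polynomials are $\omega_p(x)=\sum_{k=0}^{p} S(p,k)\,k!\,x^k$ for integers $p\ge 0$, so $\omega_0(x)=1$, $\omega_1(x)=x$, $\omega_2(x)=2x^2+x$. Here $x$ is a real or complex number. *)

theory Defs
  imports Complex_Main "HOL-Combinatorics.Stirling"
begin

(* The library constant Stirling (capital S) is the Stirling number of the second kind. *)

definition geometric_poly :: "nat \<Rightarrow> 'a::comm_semiring_1 \<Rightarrow> 'a" where
  "geometric_poly p x = (\<Sum>k=0..p. of_nat (Stirling p k * fact k) * x ^ k)"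

end

(* Since n^p = sum over k of S(p,k) k! binom(n,k), the hockey-stick identity turns the power sum
   1^p + ... + n^p into the sum over k of S(p,k) k! binom(n+1,k+1).  The generating function of
   binom(n+1,k+1) is x^k / (1-x)^(k+2), which is the Cauchy product of that of binom(n,k),
   namely x^k / (1-x)^(k+1), with the geometric series. *)
theory Submission
  imports Defs
begin

text \<open>\<open>fact k * (n choose k)\<close> is the falling factorial n(n-1)...(n-k+1).
  Splitting n = k + (n - k), the factor n - k extends it by one more term; for k > n everything
  vanishes.\<close>

lemma mult_fact_binomial:
  "n * (fact k * (n choose k)) = k * (fact k * (n choose k)) + fact (Suc k) * (n choose Suc k)"
proof (cases "k \<le> n")
  case True
  have "Suc k * (n choose Suc k) = (n - k) * (n choose k)"
    using binomial_absorb_comp[of n k] binomial_absorption[of k n] by simp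
  then have "fact (Suc k) * (n choose Suc k) = (n - k) * (fact k * (n choose k))"
    by (metis fact_Suc mult.assoc mult.left_commute of_nat_id)
  with True show ?thesis
    by (metis add_mult_distrib le_add_diff_inverse)
qed (simp add: binomial_eq_0)

text \<open>Induction on p: multiplying a falling factorial by n reproduces the recurrence
  S(p+1,k+1) = (k+1) S(p,k+1) + S(p,k).\<close>

lemma power_eq_sum_Stirling:
  "n ^ p = (\<Sum>k\<le>p. Stirling p k * (fact k * (n choose k)))"
proof (induction p)
  case (Suc p)
  let ?b = "\<lambda>k. fact k * (n choose k)"
  have "n ^ Suc p = (\<Sum>k\<le>p. Stirling p k * (n * ?b k))"
    by (simp add: Suc sum_distrib_left mult.left_commute)
  also have "\<dots> = (\<Sum>k\<le>p. k * Stirling p k * ?b k) + (\<Sum>k\<le>p. Stirling p k * ?b (Suc k))"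
    by (simp only: mult_fact_binomial distrib_left sum.distrib mult.assoc mult.left_commute)
  \<comment> \<open>The extra term is zero since S(p,p+1) = 0; the shift that follows drops the term
    k = 0, killed by its factor k.\<close>
  also have "(\<Sum>k\<le>p. k * Stirling p k * ?b k) = (\<Sum>k\<le>Suc p. k * Stirling p k * ?b k)"
    by simp
  also have "\<dots> = (\<Sum>k\<le>p. Suc k * Stirling p (Suc k) * ?b (Suc k))"
    by (subst sum.atMost_Suc_shift) simp
  also have "\<dots> + (\<Sum>k\<le>p. Stirling p k * ?b (Suc k))
      = (\<Sum>k\<le>p. Stirling (Suc p) (Suc k) * ?b (Suc k))"
    by (simp only: Stirling.simps add_mult_distrib sum.distrib)
  also have "\<dots> = (\<Sum>k\<le>Suc p. Stirling (Suc p) k * ?b k)"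
    by (simp add: sum.atMost_Suc_shift del: sum.atMost_Suc Stirling.simps(4) fact_Suc binomial_Suc_Suc)
  finally show ?case .
qed simp

lemma sum_power_eq_sum_Stirling:
  assumes "p > 0"
  shows "(\<Sum>j=1..n. j ^ p) = (\<Sum>k\<le>p. Stirling p k * (fact k * (Suc n choose Suc k)))"
proof -
  \<comment> \<open>The hockey-stick sum starts at j = 0; this index is harmless because 0^p = 0 for
    p > 0.\<close>
  have "(\<Sum>j=1..n. j ^ p) = (\<Sum>j\<le>n. j ^ p)"
    by (rule sum.mono_neutral_left) (use assms in \<open>auto simp: not_le\<close>)
  also have "\<dots> = (\<Sum>k\<le>p. \<Sum>j\<le>n. Stirling p k * (fact k * (j choose k)))"
    unfolding power_eq_sum_Stirling by (rule sum.swap)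
  also have "\<dots> = (\<Sum>k\<le>p. Stirling p k * (fact k * (Suc n choose Suc k)))"
    by (simp only: sum_choose_upper flip: sum_distrib_left)
  finally show ?thesis .
qed

text \<open>Hockey-stick identity at the level of coefficients. The semiring generality lets it
  serve both for x and for the real number \<open>norm x\<close>.\<close>

lemma Cauchy_product_binomial_geometric:
  fixes x :: "'a::comm_semiring_1"
  shows "(\<Sum>i\<le>n. of_nat (i choose k) * x ^ i * x ^ (n - i)) = of_nat (Suc n choose Suc k) * x ^ n"
proof -
  have "(\<Sum>i\<le>n. of_nat (i choose k) * x ^ i * x ^ (n - i)) = (\<Sum>i\<le>n. of_nat (i choose k) * x ^ n)"
    by (intro sum.cong) (simp_all add: mult.assoc flip: power_add)
  also have "\<dots> = of_nat (Suc n choose Suc k) * x ^ n"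
    by (simp only: sum_choose_upper flip: sum_distrib_right of_nat_sum)
  finally show ?thesis .
qed

text \<open>Used to pass from the coefficients binom(n+1,k+1) to binom(n,k+1), which vanish at n =
  0.\<close>

lemma sums_mult_Suc_shift:
  fixes x :: "'a::real_normed_field"
  assumes "(\<lambda>n. a (Suc n) * x ^ n) sums s" "a 0 = 0"
  shows "(\<lambda>n. a n * x ^ n) sums (x * s)"
proof -
  have "(\<lambda>n. a (Suc n) * x ^ Suc n) sums (x * s)"
    using sums_mult[OF assms(1), of x] by (simp add: mult.left_commute)
  then show ?thesis
    using assms(2) sums_Suc_imp[of "\<lambda>n. a n * x ^ n"] by simp
qed

text \<open>Absolute convergence is what justifies the Cauchy products below. The induction itself
  multiplies the series in \<open>norm x\<close> by a geometric series and then shifts the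
  index.\<close>

lemma summable_norm_binomial:
  fixes x :: "'a::real_normed_field"
  assumes "norm x < 1"
  shows "summable (\<lambda>n. norm (of_nat (n choose k) * x ^ n))"
proof (induction k)
  case 0
  then show ?case
    using assms by (simp add: norm_power summable_geometric)
next
  case (Suc k)
  let ?r = "norm x"
  have "summable (\<lambda>n. \<Sum>i\<le>n. of_nat (i choose k) * ?r ^ i * ?r ^ (n - i))"
    using Suc assms
    by (intro summable_Cauchy_product) (simp_all add: norm_mult norm_power summable_geometric)
  then have "summable (\<lambda>n. of_nat (Suc n choose Suc k) * ?r ^ n)"
    by (simp only: Cauchy_product_binomial_geometric)
  from sums_mult_Suc_shift[OF summable_sums[OF this]]
  have "summable (\<lambda>n. of_nat (n choose Suc k) * ?r ^ n)"
    by (auto intro: sums_summable)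
  then show ?case
    by (simp add: norm_mult norm_power)
qed

lemma sums_binomial_Suc:
  fixes x :: "'a::{real_normed_field,banach}"
  assumes x: "norm x < 1" and "(\<lambda>n. of_nat (n choose k) * x ^ n) sums s"
  shows "(\<lambda>n. of_nat (Suc n choose Suc k) * x ^ n) sums (s / (1 - x))"
proof -
  have "(\<lambda>n. \<Sum>i\<le>n. of_nat (i choose k) * x ^ i * x ^ (n - i)) sums
      ((\<Sum>n. of_nat (n choose k) * x ^ n) * (\<Sum>n. x ^ n))"
    using x by (intro Cauchy_product_sums summable_norm_binomial)
      (simp_all add: norm_power summable_geometric)
  then show ?thesis
    using assms by (simp only: Cauchy_product_binomial_geometric suminf_geometric
      sums_unique[symmetric] times_divide_eq_right mult_1_right)
qed

text \<open>Each induction step gains 1/(1-x) from the geometric factor and x from the index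
  shift.\<close>

lemma sums_binomial:
  fixes x :: "'a::{real_normed_field,banach}"
  assumes "norm x < 1"
  shows "(\<lambda>n. of_nat (n choose k) * x ^ n) sums (x ^ k / (1 - x) ^ Suc k)"
proof (induction k)
  case 0
  then show ?case
    using geometric_sums[OF assms] by simp
next
  case (Suc k)
  from sums_mult_Suc_shift[OF sums_binomial_Suc[OF assms this]]
  show ?case
    by (simp add: mult.commute)
qed

theorem mainTheorem3:
  fixes p :: nat and x :: "'a::{real_normed_field,banach}"
  assumes "p > 0" and "norm x < 1"
  shows "(\<lambda>n. (\<Sum>j=1..Suc n. of_nat j ^ p) * x ^ Suc n) sums
           (1 / (1 - x)\<^sup>2 * geometric_poly p (x / (1 - x)))"
proof -
  let ?c = "\<lambda>k. of_nat (Stirling p k * fact k) :: 'a"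
  let ?f = "\<lambda>n. (\<Sum>j=1..n. of_nat j ^ p) * x ^ n"
  have "?f n = (\<Sum>k\<le>p. ?c k * (of_nat (Suc n choose Suc k) * x ^ n))" for n
  proof -
    have "(\<Sum>j=1..n. of_nat j ^ p) = (of_nat (\<Sum>j=1..n. j ^ p) :: 'a)"
      by simp
    also have "\<dots> = (\<Sum>k\<le>p. ?c k * of_nat (Suc n choose Suc k))"
      unfolding sum_power_eq_sum_Stirling[OF assms(1)]
      by (simp only: of_nat_sum of_nat_mult mult.assoc)
    finally show ?thesis
      by (simp only: sum_distrib_right mult.assoc)
  qed
  moreover have "(\<lambda>n. \<Sum>k\<le>p. ?c k * (of_nat (Suc n choose Suc k) * x ^ n)) sums
      (\<Sum>k\<le>p. ?c k * (x ^ k / (1 - x) ^ Suc k / (1 - x)))"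
    by (intro sums_sum sums_mult sums_binomial_Suc sums_binomial assms)
  \<comment> \<open>Of the k + 2 factors 1/(1-x), two come out in front and k combine with
    x^k.\<close>
  moreover have "(\<Sum>k\<le>p. ?c k * (x ^ k / (1 - x) ^ Suc k / (1 - x)))
      = 1 / (1 - x)\<^sup>2 * geometric_poly p (x / (1 - x))"
    unfolding geometric_poly_def sum_distrib_left atLeast0AtMost
    by (intro sum.cong) (simp_all add: power_divide power2_eq_square mult_ac)
  ultimately have "?f sums (1 / (1 - x)\<^sup>2 * geometric_poly p (x / (1 - x)))"
    by simp
  \<comment> \<open>The term of \<open>?f\<close> at n = 0 is an empty sum, so starting at n = 1
    keeps the value.\<close>
  then show ?thesis
    using sums_Suc_iff[of ?f] by simp
qed

end
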